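(* Let $N,n_\omega$ be positive integers, $\alpha\in(0,1)$, let $\theta\ge 0$ be the radius of the ambiguity set, let $\widehat\omega_1,\dots,\widehat\omega_N\in\mathbb{R}_{\ge0}^{n_\omega}$ be samples, fix $j\in\{1,\dots,n_\omega\}$, and let $\widehat\omega_{ij}\ge 0$ be the $j$-th component of the sample $\widehat\omega_i$. Let $\mathcal{M}_N^\theta$ be the Wasserstein ambiguity set of radius $\theta$ on $\mathbb{R}_{\ge0}$ around the empirical distribution of $\widehat\omega_{1j},\dots,\widehat\omega_{Nj}$. Then the distributionally robust chance-constrained program $$\min_{(\underline{y},\overline{y})\in\mathbb{R}^2}\ \overline{y}-\underline{y}\quad\text{s.t.}\quad 0\le\underline{y}\le\overline{y},\qquad \sup_{\mathbb{P}\in\mathcal{M}_N^\theta}\mathbb{P}\big[\omega\notin[\underline{y},\overline{y}]\big]\le\frac{\alpha}{n_\omega}$$ (where $\omega$ is the scalar random variable with distribution $\mathbb{P}$, supported on $\mathbb{R}_{\ge0}$) can be equivalently stated as $$\begin{aligned} \min_{\underline{y},\overline{y},\lambda,s}\quad & \overline{y}-\underline{y}\\ \text{s.t.}\quad & 0\le\underline{y}\le\overline{y},\\ & \lambda\theta+\frac1N\sum_{i=1}^N s_i\le\frac{\alpha}{n_\omega},\\ & s_i\ge 1-\lambda\max\{0,\overline{y}-\widehat\omega_{ij}\},\\ & s_i\ge 1-\lambda\max\{0,\widehat\omega_{ij}-\underline{y}\}\quad\text{if }\underline{y}>0,\\ & \lambda\ge0,\quad s_i\ge0,\quad\forall i\in\{1,\dots,N\},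 \end{aligned}$$ where the constraints on $s_i$ hold for all $i\in\{1,\dots,N\}$, and the second lower bound on $s_i$ is imposed only when $\underline{y}>0$. Equivalence means that the two programs have the same objective and that $(\underline{y},\overline{y})$ is feasible for the first program if and only if there exist $\lambda\in\mathbb{R}$ and $s\in\mathbb{R}^N$ such that $(\underline{y},\overline{y},\lambda,s)$ is feasible for the second.
   Context: Let $\mathcal{P}_1(\mathbb{R}_{\ge0})$ be the set of Borel probability measures supported on $\mathbb{R}_{\ge0}=[0,\infty)$ with finite first moment. For $\mu,\nu\in\mathcal{P}_1(\mathbb{R}_{\ge0})$ the (type-1) Wasserstein distance is $W_1(\mu,\nu):=\inf_\gamma\int|\omega-\omega'|\,\gamma(d\omega,d\omega')$, the infimum being over all couplings $\gamma$ of $\mu$ and $\nu$. The empirical distribution of the $j$-th components is $\widehat{\mathbb{P}}_N:=\frac1N\sum_{i=1}^N\delta_{\widehat\omega_{ij}}$, where $\delta_{\widehat\omega_{ij}}$ is the unit point mass at $\widehat\omega_{ij}$, and the Wasserstein ambiguity set is $$\mathcal{M}_N^\theta:=\{\mu\in\mathcal{P}_1(\mathbb{R}_{\ge0})\mid W_1(\mu,\widehat{\mathbb{P}}_N)\le\theta\}.$$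
   Formalization: The equivalence is stated for θ>0, as it fails at θ=0 (all samples 1, interval [0,1]); at θ=0 only this is stated: feasibility in the second program implies it in the first, and conversely when no sample equals the upper endpoint, or the lower endpoint if that is positive. *)

theory Defs
  imports "HOL-Probability.Probability"
begin

definition P1_nonneg :: "real measure set" where
  "P1_nonneg = {\<mu>. prob_space \<mu> \<and> sets \<mu> = sets borel \<and>
     emeasure \<mu> {0..} = 1 \<and> integrable \<mu> (\<lambda>x. x)}"

definition couplings :: "real measure \<Rightarrow> real measure \<Rightarrow> (real \<times> real) measure set" where
  "couplings \<mu> \<nu> = {\<gamma>. prob_space \<gamma> \<and> sets \<gamma> = sets (borel \<Otimes>\<^sub>M borel) \<and>
     distr \<gamma> borel fst = \<mu> \<and> distr \<gamma> borel snd = \<nu>}"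

definition W1 :: "real measure \<Rightarrow> real measure \<Rightarrow> ennreal" where
  "W1 \<mu> \<nu> = (INF \<gamma>\<in>couplings \<mu> \<nu>. \<integral>\<^sup>+ (\<omega>, \<omega>'). ennreal \<bar>\<omega> - \<omega>'\<bar> \<partial>\<gamma>)"

definition empirical :: "real ^ 'N \<Rightarrow> real measure" where
  "empirical x = measure_of UNIV (sets borel)
     (\<lambda>A. (\<Sum>i\<in>UNIV. emeasure (return borel (x $ i)) A) / of_nat CARD('N))"

definition ambiguity_set :: "real ^ 'N \<Rightarrow> real \<Rightarrow> real measure set" where
  "ambiguity_set x \<theta> = {\<mu> \<in> P1_nonneg. W1 \<mu> (empirical x) \<le> ennreal \<theta>}"

definition chance_feasible :: "real ^ 'N \<Rightarrow> real \<Rightarrow> real \<Rightarrow> (real \<times> real) set" where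
  "chance_feasible x \<theta> \<beta> = {(yl, yu). 0 \<le> yl \<and> yl \<le> yu \<and>
     (SUP P\<in>ambiguity_set x \<theta>. emeasure P {\<omega>. \<omega> \<notin> {yl..yu}}) \<le> ennreal \<beta>}"

definition reformulation_feasible ::
  "real ^ 'N \<Rightarrow> real \<Rightarrow> real \<Rightarrow> ((real \<times> real) \<times> (real \<times> (real ^ 'N))) set" where
  "reformulation_feasible x \<theta> \<beta> = {((yl, yu), (l, s)).
     0 \<le> yl \<and> yl \<le> yu \<and>
     l * \<theta> + (1 / real CARD('N)) * (\<Sum>i\<in>UNIV. s $ i) \<le> \<beta> \<and>
     (\<forall>i. s $ i \<ge> 1 - l * max 0 (yu - x $ i)) \<and>
     (\<forall>i. yl > 0 \<longrightarrow> s $ i \<ge> 1 - l * max 0 (x $ i - yl)) \<and>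
     l \<ge> 0 \<and> (\<forall>i. s $ i \<ge> 0)}"

definition equivalent_programs ::
  "('a \<Rightarrow> real) \<Rightarrow> 'a set \<Rightarrow> ('a \<times> 'b \<Rightarrow> real) \<Rightarrow> ('a \<times> 'b) set \<Rightarrow> bool" where
  "equivalent_programs f F g G \<longleftrightarrow>
     (\<forall>u v. g (u, v) = f u) \<and> (\<forall>u. u \<in> F \<longleftrightarrow> (\<exists>v. (u, v) \<in> G))"

lemma empirical_eq_distr:
  fixes x :: "real ^ 'N"
  shows "empirical x = distr (uniform_count_measure UNIV) borel (\<lambda>i. x $ i)"
proof -
  let ?M = "distr (uniform_count_measure (UNIV :: 'N set)) borel (\<lambda>i. x $ i)"
  have eq: "emeasure ?M A = (\<Sum>i\<in>UNIV. emeasure (return borel (x $ i)) A) / of_nat CARD('N)"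
    if "A \<in> sets borel" for A
  proof -
    have "emeasure ?M A = emeasure (uniform_count_measure (UNIV :: 'N set)) {i. x $ i \<in> A}"
      using that by (subst emeasure_distr) (auto simp: space_uniform_count_measure measurable_def
          sets_uniform_count_measure vimage_def)
    also have "\<dots> = of_nat (card {i. x $ i \<in> A}) / of_nat CARD('N)"
      by (subst emeasure_uniform_count_measure) (auto simp: divide_ennreal ennreal_of_nat_eq_real_of_nat)
    also have "of_nat (card {i. x $ i \<in> A}) = (\<Sum>i\<in>UNIV. emeasure (return borel (x $ i)) A)"
      using that by (simp add: indicator_def of_bool_def sum.If_cases)
    finally show ?thesis .
  qed
  have "empirical x = measure_of UNIV (sets borel) (emeasure ?M)"
    unfolding empirical_def by (rule measure_of_eq) (auto simp: eq sigma_algebra.sigma_sets_eq sets.sigma_algebra_axioms 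
       sets.sigma_sets_eq[of "borel :: real measure", simplified])
  also have "\<dots> = ?M"
    using measure_of_of_measure[of ?M] by simp
  finally show ?thesis .
qed

lemma emeasure_empirical:
  fixes x :: "real ^ 'N"
  assumes "A \<in> sets borel"
  shows "emeasure (empirical x) A = of_nat (card {i. x $ i \<in> A}) / of_nat CARD('N)"
  unfolding empirical_eq_distr using assms
  by (subst emeasure_distr) (auto simp: space_uniform_count_measure measurable_def vimage_def
      sets_uniform_count_measure emeasure_uniform_count_measure divide_ennreal ennreal_of_nat_eq_real_of_nat)

(* Why the main theorem separates radius 0 from positive radii.  At radius 0 the ambiguity set is
   the single point given by the empirical distribution.  A sample on an endpoint of the closed
   interval then costs nothing in the first program, but forces s_i >= 1 in the second one, so
   that the equivalence fails. *)
lemma not_equivalent_radius_zero: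
  assumes "0 < \<beta>" "\<beta> < 1"
  shows "\<not> equivalent_programs (\<lambda>(yl, yu). yu - yl) (chance_feasible (\<chi> i::'N::finite. 1) 0 \<beta>)
           (\<lambda>((yl, yu), _). yu - yl) (reformulation_feasible (\<chi> i::'N. 1) 0 \<beta>)"
proof -
  let ?x = "(\<chi> i. 1) :: real ^ 'N"
  have P0: "emeasure P {\<omega>. \<omega> \<notin> {0..1}} = 0" if P: "P \<in> ambiguity_set ?x 0" for P
  proof -
    have setsP: "sets P = sets borel" and W: "W1 P (empirical ?x) = 0"
      using P by (auto simp: ambiguity_set_def P1_nonneg_def)
    have "(\<integral>\<^sup>+ \<omega>. ennreal \<bar>\<omega> - 1\<bar> \<partial>P) \<le> (\<integral>\<^sup>+ (\<omega>, \<omega>'). ennreal \<bar>\<omega> - \<omega>'\<bar> \<partial>\<gamma>)"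
      if g: "\<gamma> \<in> couplings P (empirical ?x)" for \<gamma>
    proof -
      have s: "sets \<gamma> = sets (borel \<Otimes>\<^sub>M borel)" and d1: "distr \<gamma> borel fst = P"
        and d2: "distr \<gamma> borel snd = empirical ?x"
        using g by (auto simp: couplings_def)
      have m1: "fst \<in> \<gamma> \<rightarrow>\<^sub>M borel" and m2: "snd \<in> \<gamma> \<rightarrow>\<^sub>M borel"
        using measurable_fst measurable_snd by (simp_all cong: measurable_cong_sets add: s)
      have "emeasure (distr \<gamma> borel snd) (- {1}) = 0"
        unfolding d2 by (subst emeasure_empirical) auto
      then have "AE \<omega>' in distr \<gamma> borel snd. \<omega>' = 1"
        by (intro AE_I[of _ _ "- {1}"]) auto
      then have ae: "AE z in \<gamma>. snd z = 1"
        using m2 by (subst (asm) AE_distr_iff) auto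
      have "(\<integral>\<^sup>+ \<omega>. ennreal \<bar>\<omega> - 1\<bar> \<partial>P) = (\<integral>\<^sup>+ z. ennreal \<bar>fst z - 1\<bar> \<partial>\<gamma>)"
        unfolding d1[symmetric] using m1 by (subst nn_integral_distr) auto
      also have "\<dots> = (\<integral>\<^sup>+ (\<omega>, \<omega>'). ennreal \<bar>\<omega> - \<omega>'\<bar> \<partial>\<gamma>)"
        using ae by (intro nn_integral_cong_AE) (auto simp: case_prod_beta)
      finally show ?thesis by simp
    qed
    then have "(\<integral>\<^sup>+ \<omega>. ennreal \<bar>\<omega> - 1\<bar> \<partial>P) \<le> W1 P (empirical ?x)"
      unfolding W1_def by (intro INF_greatest) auto
    then have "(\<integral>\<^sup>+ \<omega>. ennreal \<bar>\<omega> - 1\<bar> \<partial>P) = 0"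
      using W by simp
    moreover have "(\<lambda>\<omega>. ennreal \<bar>\<omega> - 1\<bar>) \<in> borel_measurable P"
      by (simp cong: measurable_cong_sets add: setsP)
    ultimately have "AE \<omega> in P. ennreal \<bar>\<omega> - 1\<bar> = 0"
      by (subst (asm) nn_integral_0_iff_AE) auto
    then have ae: "AE \<omega> in P. \<not> \<omega> \<notin> {0..1}"
      by eventually_elim (auto simp: ennreal_eq_0_iff)
    have sp: "space P = UNIV"
      using sets_eq_imp_space_eq[OF setsP] by simp
    have "{\<omega>::real. \<omega> \<notin> {0..1}} = - {0..1}" by auto
    then have "{\<omega>. \<omega> \<notin> {0..1}} \<in> sets P"
      unfolding setsP by simp
    then show ?thesis
      using ae by (subst (asm) AE_iff_measurable[of "{\<omega>. \<omega> \<notin> {0..1}}"]) (auto simp: sp)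
  qed
  have "(0, 1) \<in> chance_feasible ?x 0 \<beta>"
    using P0 assms by (auto simp: chance_feasible_def intro!: SUP_least)
  moreover have "((0, 1), (l, s)) \<notin> reformulation_feasible ?x 0 \<beta>" for l s
  proof
    assume "((0, 1), (l, s)) \<in> reformulation_feasible ?x 0 \<beta>"
    then have a: "\<And>i. s $ i \<ge> 1" and b: "(1 / real CARD('N)) * (\<Sum>i\<in>UNIV. s $ i) \<le> \<beta>"
      by (auto simp: reformulation_feasible_def)
    have "(\<Sum>i\<in>UNIV. s $ i) \<ge> (\<Sum>i\<in>(UNIV::'N set). 1)"
      using a by (intro sum_mono) auto
    then have "(1 / real CARD('N)) * (\<Sum>i\<in>UNIV. s $ i) \<ge> 1"
      by (simp add: field_simps)
    with b assms show False by linarith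
  qed
  ultimately show ?thesis
    unfolding equivalent_programs_def by auto
qed

end

theory Submission
  imports Defs
begin

text \<open>Let d(w) be the distance from w \<ge> 0 to the exit region, the part of [0,oo) outside
  [yl,yu]. Moving a unit of mass from the sample x_i out of the interval costs about d(x_i). For
  fixed l the best s_i is max 0 (1 - l d(x_i)), so the second program asks for some l \<ge> 0 with l
  \<theta> + (1/N) \<Sum> max 0 (1 - l d(x_i)) \<le> \<beta>. The left side is the dual objective of
  a fractional knapsack problem: maximize (1/N) \<Sum> r_i over 0 \<le> r_i \<le> 1 with (1/N)
  \<Sum> r_i d(x_i) \<le> \<theta>.

  By weak duality (\<open>emeasure_outside_le\<close>), every dual value bounds the worst-case exit
  probability. Conversely, a knapsack solution, scaled down slightly, is a transport plan to a
  distribution in the ambiguity set (\<open>chance_feasible_transport\<close>,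
  \<open>chance_feasible_fractional\<close>). Feasibility for the first program therefore bounds the
  knapsack value by \<beta>, and \<open>fractional_knapsack_duality\<close> supplies a multiplier
  with that same value.

  Since d need not be attained, this converse spends some slack in \<theta>. At radius 0 there is no
  slack; the converse is then proved for intervals with no sample at \<open>yu\<close> or at a
  positive \<open>yl\<close>, where d(x_i) = 0 happens only for samples that really lie
  outside.\<close>

section \<open>Distance to the exit region and elimination of \<open>s\<close>\<close>

text \<open>The case split reflects the support: when \<open>yl\<close> is 0, no nonnegative point
  lies to the left of the interval, so the only exit is to the right.\<close>

definition exit_dist :: "real \<Rightarrow> real \<Rightarrow> real \<Rightarrow> real" where
  "exit_dist yl yu w =
     (if yl > 0 then min (max 0 (yu - w)) (max 0 (w - yl)) else max 0 (yu - w))"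

lemma exit_dist_nonneg: "0 \<le> exit_dist yl yu w"
  by (auto simp: exit_dist_def)

lemma exit_dist_le:
  assumes "v \<notin> {yl..yu}" "0 \<le> v"
  shows "exit_dist yl yu w \<le> \<bar>v - w\<bar>"
  using assms by (auto simp: exit_dist_def min_def max_def)

text \<open>The exit region is relatively open in [0,oo), so from inside the interval its distance
  is an infimum that is only approached; hence the \<epsilon>.\<close>

lemma exit_dist_approx:
  assumes "0 \<le> w" "0 < \<epsilon>"
  obtains z where "0 \<le> z" "z \<notin> {yl..yu}" "\<bar>z - w\<bar> \<le> exit_dist yl yu w + \<epsilon>"
proof (cases "w \<in> {yl..yu}")
  case False
  then show ?thesis using assms exit_dist_nonneg[of yl yu w] by (intro that[of w]) auto
next
  case w: True
  show ?thesis
  proof (cases "yl > 0 \<and> w - yl < yu - w")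
    case True
    \<comment> \<open>Leave through the nearer, left end. Cutting off at 0 keeps the point in the
      support, and it stays below \<open>yl\<close> because \<open>yl\<close> is positive.\<close>
    then show ?thesis using w assms
      by (intro that[of "max 0 (yl - \<epsilon>)"]) (auto simp: exit_dist_def min_def max_def)
  next
    case False
    then show ?thesis using w assms
      by (intro that[of "yu + \<epsilon>"]) (auto simp: exit_dist_def min_def max_def)
  qed
qed

text \<open>The larger of the two lower bounds on \<open>s $ i\<close> is 1 minus \<open>l\<close>
  times the smaller distance. The budget constraint is monotone in \<open>s\<close>, so the least
  admissible \<open>s\<close> may be taken.\<close>

lemma reformulation_feasible_iff:
  fixes x :: "real ^ 'N"
  shows "(\<exists>v. ((yl, yu), v) \<in> reformulation_feasible x \<theta> \<beta>) \<longleftrightarrow>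
    0 \<le> yl \<and> yl \<le> yu \<and> (\<exists>l\<ge>0. l * \<theta> +
      (\<Sum>i\<in>UNIV. max 0 (1 - l * exit_dist yl yu (x $ i))) / real CARD('N) \<le> \<beta>)"
    (is "?L \<longleftrightarrow> ?R")
proof
  assume ?L
  then obtain l s where h: "0 \<le> yl" "yl \<le> yu" "l \<ge> 0"
    "l * \<theta> + (1 / real CARD('N)) * (\<Sum>i\<in>UNIV. s $ i) \<le> \<beta>"
    "\<And>i. s $ i \<ge> 1 - l * max 0 (yu - x $ i)"
    "\<And>i. yl > 0 \<Longrightarrow> s $ i \<ge> 1 - l * max 0 (x $ i - yl)" "\<And>i. s $ i \<ge> 0"
    by (auto simp: reformulation_feasible_def)
  have "max 0 (1 - l * exit_dist yl yu (x $ i)) \<le> s $ i" for i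
    using h(5-7)[of i] by (auto simp: exit_dist_def min_def)
  then have "(\<Sum>i\<in>UNIV. max 0 (1 - l * exit_dist yl yu (x $ i))) \<le> (\<Sum>i\<in>UNIV. s $ i)"
    by (intro sum_mono)
  then have "(\<Sum>i\<in>UNIV. max 0 (1 - l * exit_dist yl yu (x $ i))) / real CARD('N)
      \<le> (\<Sum>i\<in>UNIV. s $ i) / real CARD('N)"
    by (intro divide_right_mono) auto
  with h(1-4) show ?R by (auto intro!: exI[of _ l])
next
  assume ?R
  then obtain l where h: "0 \<le> yl" "yl \<le> yu" "l \<ge> 0"
    "l * \<theta> + (\<Sum>i\<in>UNIV. max 0 (1 - l * exit_dist yl yu (x $ i))) / real CARD('N) \<le> \<beta>"
    by auto
  have "l * exit_dist yl yu w \<le> l * max 0 (yu - w)"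
    "yl > 0 \<Longrightarrow> l * exit_dist yl yu w \<le> l * max 0 (w - yl)" for w
    by (intro mult_left_mono[OF _ h(3)]; simp add: exit_dist_def)+
  then have "((yl, yu), (l, \<chi> i. max 0 (1 - l * exit_dist yl yu (x $ i))))
      \<in> reformulation_feasible x \<theta> \<beta>"
    using h by (auto simp: reformulation_feasible_def le_max_iff_disj)
  then show ?L by blast
qed

section \<open>Weak duality\<close>

lemma nn_integral_empirical:
  fixes x :: "real ^ 'N"
  assumes "f \<in> borel_measurable borel" "\<And>w. 0 \<le> f w"
  shows "(\<integral>\<^sup>+ w. ennreal (f w) \<partial>empirical x) = ennreal ((\<Sum>i\<in>UNIV. f (x $ i)) / real CARD('N))"
proof -
  have m: "($) x \<in> measurable (uniform_count_measure UNIV) borel"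
    by (auto simp: measurable_def space_uniform_count_measure sets_uniform_count_measure)
  have "(\<integral>\<^sup>+ w. ennreal (f w) \<partial>empirical x)
      = (\<integral>\<^sup>+ i. ennreal (f (x $ i)) \<partial>uniform_count_measure UNIV)"
    unfolding empirical_eq_distr using assms(1) m by (subst nn_integral_distr) auto
  also have "\<dots> = (\<Sum>i\<in>UNIV. ennreal (f (x $ i) / real CARD('N)))"
    unfolding uniform_count_measure_def
    by (subst nn_integral_point_measure_finite)
       (auto simp: ennreal_mult'[symmetric] assms(2) mult.commute intro!: sum.cong)
  also have "\<dots> = ennreal ((\<Sum>i\<in>UNIV. f (x $ i)) / real CARD('N))"
    by (subst sum_ennreal) (auto simp: assms(2) sum_divide_distrib)
  finally show ?thesis .
qed

text \<open>Weak duality: the function \<open>1 - l d\<close>, with \<open>d\<close> the distance to the exit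
  region, truncated at 0, is the price of a sample; the indicator of the exit region at
  \<open>v\<close> is at most the price of \<open>w\<close> plus \<open>l\<close> times the transport cost from
  \<open>v\<close> to \<open>w\<close>.\<close>

lemma emeasure_outside_le:
  fixes x :: "real ^ 'N"
  assumes P: "P \<in> ambiguity_set x \<theta>" and "0 \<le> \<theta>" "0 \<le> l"
  shows "emeasure P {\<omega>. \<omega> \<notin> {yl..yu}} \<le> ennreal (l * \<theta> +
    (\<Sum>i\<in>UNIV. max 0 (1 - l * exit_dist yl yu (x $ i))) / real CARD('N))"
proof -
  define S where "S w = max 0 (1 - l * exit_dist yl yu w)" for w
  define U where "U = - {yl..yu}"
  have U: "{\<omega>. \<omega> \<notin> {yl..yu}} = U" "U \<in> sets borel" by (auto simp: U_def)
  have S: "S \<in> borel_measurable borel" "\<And>w. 0 \<le> S w"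
    unfolding S_def exit_dist_def by auto
  have pr: "prob_space P" and sP: "sets P = sets borel" and P1: "emeasure P {0..} = 1"
    and W: "W1 P (empirical x) \<le> ennreal \<theta>"
    using P by (auto simp: ambiguity_set_def P1_nonneg_def)
  \<comment> \<open>\<open>exit_dist\<close> ignores exits to negative points, so the pointwise
    bound \<open>pt\<close> below is available only for nonnegative \<open>v\<close>.\<close>
  have aeP: "AE w in P. 0 \<le> w"
  proof -
    interpret prob_space P by fact
    have "AE w in P. w \<in> {0..}"
      by (subst AE_in_set_eq_1) (auto simp: sP P1 measure_def)
    then show ?thesis by simp
  qed
  have bound: "emeasure P U \<le> ennreal l * (\<integral>\<^sup>+ (\<omega>, \<omega>'). ennreal \<bar>\<omega> - \<omega>'\<bar> \<partial>\<gamma>)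
      + ennreal ((\<Sum>i\<in>UNIV. S (x $ i)) / real CARD('N))"
    if g: "\<gamma> \<in> couplings P (empirical x)" for \<gamma>
  proof -
    have s[measurable_cong]: "sets \<gamma> = sets (borel \<Otimes>\<^sub>M borel)" and d1: "distr \<gamma> borel fst = P"
      and d2: "distr \<gamma> borel snd = empirical x"
      using g by (auto simp: couplings_def)
    note S(1)[measurable] U(2)[measurable]
    have m1: "fst \<in> \<gamma> \<rightarrow>\<^sub>M borel" and m2: "snd \<in> \<gamma> \<rightarrow>\<^sub>M borel"
      by measurable
    have ae: "AE z in \<gamma>. 0 \<le> fst z"
      using aeP unfolding d1[symmetric] by (subst (asm) AE_distr_iff) (use m1 in auto)
    have pt: "indicator U v \<le> ennreal l * ennreal \<bar>v - w\<bar> + ennreal (S w)" if "0 \<le> v" for v w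
    proof (cases "v \<in> U")
      case True
      then have "l * exit_dist yl yu w \<le> l * \<bar>v - w\<bar>"
        using that assms(3) by (intro mult_left_mono exit_dist_le) (auto simp: U_def)
      then have "1 \<le> l * \<bar>v - w\<bar> + S w" by (auto simp: S_def)
      then have "ennreal 1 \<le> ennreal (l * \<bar>v - w\<bar> + S w)" by (rule ennreal_leI)
      then show ?thesis using True assms(3) S(2)[of w] by (simp add: ennreal_mult)
    qed auto
    have "emeasure P U = (\<integral>\<^sup>+ v. indicator U v \<partial>P)"
      using U sP by simp
    also have "\<dots> = (\<integral>\<^sup>+ z. indicator U (fst z) \<partial>\<gamma>)"
      unfolding d1[symmetric] by (subst nn_integral_distr) (use m1 in auto)
    also have "\<dots> \<le> (\<integral>\<^sup>+ z. ennreal l * ennreal \<bar>fst z - snd z\<bar> + ennreal (S (snd z)) \<partial>\<gamma>)"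
      using ae by (intro nn_integral_mono_AE) (auto elim!: eventually_mono intro!: pt)
    also have "\<dots> = ennreal l * (\<integral>\<^sup>+ z. ennreal \<bar>fst z - snd z\<bar> \<partial>\<gamma>)
        + (\<integral>\<^sup>+ z. ennreal (S (snd z)) \<partial>\<gamma>)"
      by (subst nn_integral_add) (auto simp: nn_integral_cmult)
    also have "(\<integral>\<^sup>+ z. ennreal (S (snd z)) \<partial>\<gamma>) = (\<integral>\<^sup>+ w. ennreal (S w) \<partial>empirical x)"
      unfolding d2[symmetric] by (subst nn_integral_distr) (use m2 in auto)
    also have "\<dots> = ennreal ((\<Sum>i\<in>UNIV. S (x $ i)) / real CARD('N))"
      by (rule nn_integral_empirical[OF S])
    finally show ?thesis by (simp add: split_beta')
  qed
  have avg: "0 \<le> (\<Sum>i\<in>UNIV. S (x $ i)) / real CARD('N)"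
    by (intro divide_nonneg_nonneg sum_nonneg S(2)) auto
  have "emeasure P U \<le> ennreal (l * \<theta> + (\<Sum>i\<in>UNIV. S (x $ i)) / real CARD('N))"
  proof (rule ennreal_le_epsilon)
    fix e :: real assume e: "0 < e"
    \<comment> \<open>A nearly optimal coupling suffices. The excess is divided by
      \<open>l + 1\<close> rather than \<open>l\<close> to cover \<open>l = 0\<close>; multiplied by
      \<open>l\<close> it stays at most \<open>e\<close>.\<close>
    have "W1 P (empirical x) < ennreal (\<theta> + e / (l + 1))"
      using W e assms by (intro le_less_trans[OF W] ennreal_lessI) (auto simp: add_nonneg_pos)
    then obtain \<gamma> where g: "\<gamma> \<in> couplings P (empirical x)"
      "(\<integral>\<^sup>+ (\<omega>, \<omega>'). ennreal \<bar>\<omega> - \<omega>'\<bar> \<partial>\<gamma>) < ennreal (\<theta> + e / (l + 1))"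
      unfolding W1_def INF_less_iff by auto
    have "emeasure P U \<le> ennreal l * ennreal (\<theta> + e / (l + 1))
        + ennreal ((\<Sum>i\<in>UNIV. S (x $ i)) / real CARD('N))"
      using g by (intro order_trans[OF bound[OF g(1)]] add_right_mono mult_left_mono) auto
    also have "\<dots> = ennreal (l * (\<theta> + e / (l + 1)) + (\<Sum>i\<in>UNIV. S (x $ i)) / real CARD('N))"
      using assms e avg by (simp add: ennreal_mult)
    also have "\<dots> \<le> ennreal (l * \<theta> + (\<Sum>i\<in>UNIV. S (x $ i)) / real CARD('N) + e)"
    proof (rule ennreal_leI)
      have "l * (e / (l + 1)) \<le> e" using assms e by (simp add: field_simps)
      then show "l * (\<theta> + e / (l + 1)) + (\<Sum>i\<in>UNIV. S (x $ i)) / real CARD('N)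
          \<le> l * \<theta> + (\<Sum>i\<in>UNIV. S (x $ i)) / real CARD('N) + e"
        by (simp add: distrib_left)
    qed
    also have "\<dots> = ennreal (l * \<theta> + (\<Sum>i\<in>UNIV. S (x $ i)) / real CARD('N)) + ennreal e"
      using assms e avg by simp
    finally show "emeasure P U \<le>
      ennreal (l * \<theta> + (\<Sum>i\<in>UNIV. S (x $ i)) / real CARD('N)) + ennreal e" .
  qed
  then show ?thesis by (simp only: U(1) S_def)
qed

lemma chance_feasibleI:
  fixes x :: "real ^ 'N"
  assumes "0 \<le> \<theta>" "\<exists>v. ((yl, yu), v) \<in> reformulation_feasible x \<theta> \<beta>"
  shows "(yl, yu) \<in> chance_feasible x \<theta> \<beta>"
proof -
  obtain l where "0 \<le> yl" "yl \<le> yu" "0 \<le> l" and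
    l: "l * \<theta> + (\<Sum>i\<in>UNIV. max 0 (1 - l * exit_dist yl yu (x $ i))) / real CARD('N) \<le> \<beta>"
    using assms(2) unfolding reformulation_feasible_iff by blast
  then show ?thesis
    unfolding chance_feasible_def mem_Collect_eq case_prod_conv
    by (intro conjI SUP_least order_trans[OF emeasure_outside_le ennreal_leI[OF l]] assms(1))
qed

section \<open>Competitors in the ambiguity set\<close>

text \<open>The competitor moves, for every \<open>i\<close>, the fraction \<open>r i\<close> of the mass
  of the \<open>i\<close>-th sample to the point \<open>z i\<close>.\<close>

lemma chance_feasible_transport:
  fixes x :: "real ^ 'N"
  assumes feas: "(yl, yu) \<in> chance_feasible x \<theta> \<beta>" and "0 \<le> \<beta>"
    and x: "\<And>i. 0 \<le> x $ i" and r: "\<And>i. 0 \<le> r i" "\<And>i. r i \<le> 1"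
    and z: "\<And>i. 0 \<le> z i" "\<And>i. r i \<noteq> 0 \<Longrightarrow> z i \<notin> {yl..yu}"
    and cost: "(\<Sum>i\<in>UNIV. r i * \<bar>z i - x $ i\<bar>) \<le> \<theta> * real CARD('N)"
  shows "(\<Sum>i\<in>UNIV. r i) \<le> \<beta> * real CARD('N)"
proof -
  \<comment> \<open>Draw a sample index uniformly and flip a coin with bias \<open>r i\<close>;
    \<open>f\<close> moves the sample to \<open>z i\<close> on heads. Pairing the result with the
    original sample gives the coupling \<open>\<gamma>\<close>.\<close>
  define q :: "('N \<times> bool) pmf" where
    "q = bind_pmf (pmf_of_set UNIV) (\<lambda>i. map_pmf (Pair i) (bernoulli_pmf (r i)))"
  define f where "f = (\<lambda>(i, b). if b then z i else x $ i)"
  define P where "P = distr (measure_pmf q) borel f"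
  define \<gamma> where "\<gamma> = distr (measure_pmf q) (borel \<Otimes>\<^sub>M borel) (\<lambda>p. (f p, x $ fst p))"
  have q: "(\<integral>\<^sup>+ p. ennreal (h p) \<partial>measure_pmf q)
      = ennreal ((\<Sum>i\<in>UNIV. r i * h (i, True) + (1 - r i) * h (i, False)) / real CARD('N))"
    if h: "\<And>p. 0 \<le> h p" for h
  proof -
    have "(\<integral>\<^sup>+ p. ennreal (h p) \<partial>measure_pmf q) = 
      (\<integral>\<^sup>+ i. ennreal (r i * h (i, True) + (1 - r i) * h (i, False)) \<partial>pmf_of_set UNIV)"
      unfolding q_def
      by (simp add: r h ennreal_mult nn_integral_bernoulli_pmf mult.commute)
    also have "\<dots> = (\<Sum>i\<in>UNIV. ennreal (r i * h (i, True) + (1 - r i) * h (i, False)))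
        / ennreal (real CARD('N))"
      by (subst nn_integral_pmf_of_set) (auto simp: ennreal_of_nat_eq_real_of_nat)
    also have "\<dots> = ennreal ((\<Sum>i\<in>UNIV. r i * h (i, True) + (1 - r i) * h (i, False))
        / real CARD('N))"
      using r h by (subst sum_ennreal) (auto intro!: divide_ennreal sum_nonneg add_nonneg_nonneg)
    finally show ?thesis .
  qed
  have emq: "emeasure (measure_pmf q) B
    = ennreal ((\<Sum>i\<in>UNIV. r i * indicator B (i, True) + (1 - r i) * indicator B (i, False))
        / real CARD('N))" for B
    using q[of "indicator B"] by (simp add: ennreal_indicator)
  have f: "f p \<ge> 0" for p using x z by (auto simp: f_def split: prod.split)
  have d1: "distr \<gamma> borel fst = P"
    unfolding \<gamma>_def P_def by (subst distr_distr) (auto simp: comp_def space_pair_measure)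
  have d2: "distr \<gamma> borel snd = empirical x"
  proof (rule measure_eqI)
    show "sets (distr \<gamma> borel snd) = sets (empirical x)" by (simp add: empirical_eq_distr)
    fix A assume "A \<in> sets (distr \<gamma> borel snd)"
    then have A: "A \<in> sets borel" by simp
    have "distr \<gamma> borel snd = distr (measure_pmf q) borel (\<lambda>p. x $ fst p)"
      unfolding \<gamma>_def by (subst distr_distr) (auto simp: comp_def space_pair_measure)
    then have "emeasure (distr \<gamma> borel snd) A = ennreal ((\<Sum>i\<in>UNIV.
        r i * indicator A (x $ i) + (1 - r i) * indicator A (x $ i)) / real CARD('N))"
      using A by (simp add: emeasure_distr emq indicator_def)
    also have "\<dots> = ennreal ((\<Sum>i\<in>UNIV. indicator A (x $ i)) / real CARD('N))"
      by (simp add: algebra_simps)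
    finally show "emeasure (distr \<gamma> borel snd) A = emeasure (empirical x) A"
      using A by (simp add: emeasure_empirical divide_ennreal ennreal_of_nat_eq_real_of_nat
          indicator_def of_bool_def sum.If_cases)
  qed
  have prP: "prob_space P"
    unfolding P_def by (rule prob_space.prob_space_distr) (auto intro: prob_space_measure_pmf)
  have "\<gamma> \<in> couplings P (empirical x)"
    using d1 d2 by (auto simp: couplings_def \<gamma>_def space_pair_measure
        intro!: prob_space.prob_space_distr prob_space_measure_pmf)
  then have "W1 P (empirical x) \<le> (\<integral>\<^sup>+ (\<omega>, \<omega>'). ennreal \<bar>\<omega> - \<omega>'\<bar> \<partial>\<gamma>)"
    unfolding W1_def by (rule INF_lower)
  also have "\<dots> = (\<integral>\<^sup>+ p. ennreal \<bar>f p - x $ fst p\<bar> \<partial>measure_pmf q)"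
    unfolding \<gamma>_def by (subst nn_integral_distr) (auto simp: space_pair_measure split_beta')
  also have "\<dots> = ennreal ((\<Sum>i\<in>UNIV. r i * \<bar>z i - x $ i\<bar>) / real CARD('N))"
    by (subst q) (auto simp: f_def)
  also have "\<dots> \<le> ennreal \<theta>"
    using cost by (intro ennreal_leI) (simp add: field_simps)
  finally have W: "W1 P (empirical x) \<le> ennreal \<theta>" .
  have "emeasure P {0..} = 1"
  proof -
    have "f -` {0..} = UNIV" using f by auto
    then show ?thesis unfolding P_def
      by (subst emeasure_distr) (auto simp: measure_pmf.emeasure_space_1[simplified])
  qed
  moreover have "integrable P (\<lambda>w. w)"
    unfolding P_def by (subst integrable_distr_eq) (auto intro!: integrable_measure_pmf_finite)
  ultimately have "P \<in> ambiguity_set x \<theta>"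
    using prP W by (auto simp: ambiguity_set_def P1_nonneg_def) (auto simp: P_def)
  then have "emeasure P {\<omega>. \<omega> \<notin> {yl..yu}} \<le> ennreal \<beta>"
    using feas by (auto simp: chance_feasible_def SUP_le_iff)
  moreover have "ennreal ((\<Sum>i\<in>UNIV. r i) / real CARD('N)) \<le> emeasure P {\<omega>. \<omega> \<notin> {yl..yu}}"
  proof -
    have U: "{\<omega>. \<omega> \<notin> {yl..yu}} \<in> sets borel" by measurable
    \<comment> \<open>Only an inequality, because mass left in place may already lie outside the
      interval.\<close>
    have "(\<Sum>i\<in>UNIV. r i) \<le> (\<Sum>i\<in>UNIV. r i * indicator (f -` {\<omega>. \<omega> \<notin> {yl..yu}}) (i, True)
       + (1 - r i) * indicator (f -` {\<omega>. \<omega> \<notin> {yl..yu}}) (i, False))"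
    proof (rule sum_mono)
      fix i
      show "r i \<le> r i * indicator (f -` {\<omega>. \<omega> \<notin> {yl..yu}}) (i, True)
       + (1 - r i) * indicator (f -` {\<omega>. \<omega> \<notin> {yl..yu}}) (i, False)"
        using z(2)[of i] r[of i] by (cases "r i = 0") (auto simp: f_def indicator_def)
    qed
    then show ?thesis unfolding P_def using U
      by (subst emeasure_distr) (auto simp: emq intro!: ennreal_leI divide_right_mono)
  qed
  ultimately have "ennreal ((\<Sum>i\<in>UNIV. r i) / real CARD('N)) \<le> ennreal \<beta>" by order
  then have "(\<Sum>i\<in>UNIV. r i) / real CARD('N) \<le> \<beta>"
    using assms(2) by simp
  then show ?thesis by (simp add: field_simps)
qed

text \<open>The exit region is open, so the distances to it need not be attained; scaling \<open>r\<close>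
  by a factor slightly below 1 frees budget for the excess, which uses that the radius is
  positive.\<close>

lemma chance_feasible_fractional:
  fixes x :: "real ^ 'N"
  assumes feas: "(yl, yu) \<in> chance_feasible x \<theta> \<beta>" and "0 \<le> \<beta>" and \<theta>: "0 < \<theta>"
    and x: "\<And>i. 0 \<le> x $ i" and r: "\<And>i. 0 \<le> r i" "\<And>i. r i \<le> 1"
    and cost: "(\<Sum>i\<in>UNIV. r i * exit_dist yl yu (x $ i)) \<le> \<theta> * real CARD('N)"
  shows "(\<Sum>i\<in>UNIV. r i) \<le> \<beta> * real CARD('N)"
proof (rule field_le_mult_one_interval)
  fix c :: real assume c: "0 < c" "c < 1"
  \<comment> \<open>Each sample incurs an excess of at most \<epsilon>, and N \<epsilon> is exactly
    the part of the budget \<theta> N released by scaling with \<open>c\<close>.\<close>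
  define \<epsilon> where "\<epsilon> = (1 - c) * \<theta>"
  have \<epsilon>: "0 < \<epsilon>" using c \<theta> by (simp add: \<epsilon>_def)
  have "\<forall>i. \<exists>z. 0 \<le> z \<and> z \<notin> {yl..yu} \<and> \<bar>z - x $ i\<bar> \<le> exit_dist yl yu (x $ i) + \<epsilon>"
    by (meson exit_dist_approx x \<epsilon>)
  then obtain z where z: "\<And>i. 0 \<le> z i" "\<And>i. z i \<notin> {yl..yu}"
    "\<And>i. \<bar>z i - x $ i\<bar> \<le> exit_dist yl yu (x $ i) + \<epsilon>"
    by metis
  have "(\<Sum>i\<in>UNIV. c * r i) \<le> \<beta> * real CARD('N)"
  proof (rule chance_feasible_transport[OF feas assms(2) x, where z = z])
    have "(\<Sum>i\<in>UNIV. c * r i * \<bar>z i - x $ i\<bar>)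
        \<le> (\<Sum>i\<in>UNIV. c * (r i * exit_dist yl yu (x $ i)) + \<epsilon>)"
    proof (rule sum_mono)
      fix i
      have "c * r i * \<bar>z i - x $ i\<bar> \<le> c * r i * (exit_dist yl yu (x $ i) + \<epsilon>)"
        using c r by (intro mult_left_mono z) auto
      moreover have "c * r i * \<epsilon> \<le> 1 * \<epsilon>"
        using c r[of i] \<epsilon> by (intro mult_right_mono mult_le_one) auto
      ultimately show "c * r i * \<bar>z i - x $ i\<bar> \<le> c * (r i * exit_dist yl yu (x $ i)) + \<epsilon>"
        by (simp add: algebra_simps)
    qed
    also have "\<dots> = c * (\<Sum>i\<in>UNIV. r i * exit_dist yl yu (x $ i)) + real CARD('N) * \<epsilon>"
      by (simp add: sum.distrib sum_distrib_left)
    also have "\<dots> \<le> c * (\<theta> * real CARD('N)) + real CARD('N) * \<epsilon>"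
      using c cost by simp
    also have "\<dots> = \<theta> * real CARD('N)" by (simp add: \<epsilon>_def algebra_simps)
    finally show "(\<Sum>i\<in>UNIV. c * r i * \<bar>z i - x $ i\<bar>) \<le> \<theta> * real CARD('N)" .
  qed (use c r z in \<open>auto intro: mult_le_one\<close>)
  then show "c * (\<Sum>i\<in>UNIV. r i) \<le> \<beta> * real CARD('N)" by (simp add: sum_distrib_left)
qed

section \<open>Fractional knapsack duality\<close>

text \<open>This locates the critical cost of the greedy solution: the least cost level at which
  buying all items up to that level exceeds the budget.\<close>

lemma exists_threshold:
  fixes d :: "'a::finite \<Rightarrow> real"
  assumes "0 \<le> B" "B < (\<Sum>i\<in>UNIV. d i)"
  obtains t where "t \<in> range d" "(\<Sum>i | d i < t. d i) \<le> B" "B < (\<Sum>i | d i \<le> t. d i)"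
proof -
  define T where "T = {t \<in> range d. B < (\<Sum>i | d i \<le> t. d i)}"
  have fin: "finite T" by (simp add: T_def)
  have "{i. d i \<le> Max (range d)} = UNIV" by auto
  then have "Max (range d) \<in> T" using assms(2) by (auto simp: T_def intro!: Max_in)
  then have t: "Min T \<in> T" using fin by (intro Min_in) auto
  have "(\<Sum>i | d i < Min T. d i) \<le> B"
  proof (cases "{i. d i < Min T} = {}")
    case True
    then show ?thesis using assms by (simp only: sum.empty)
  next
    case ne: False
    \<comment> \<open>The next lower cost level: items of cost at most \<open>u\<close> are exactly
      those below the minimum of \<open>T\<close>, and \<open>u\<close> itself is affordable by
      minimality.\<close>
    define u where "u = Max (d ` {i. d i < Min T})"
    have "u \<in> d ` {i. d i < Min T}" unfolding u_def using ne by (intro Max_in) auto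
    then have u: "u \<in> range d" "u < Min T" by auto
    then have "u \<notin> T" using fin by (meson Min_le not_less)
    moreover have "{i. d i \<le> u} = {i. d i < Min T}"
      using u(2) by (auto simp: u_def intro!: Max_ge)
    ultimately show ?thesis using u(1) by (simp add: T_def)
  qed
  with t show ?thesis using that by (auto simp: T_def)
qed

text \<open>Duality for the fractional knapsack problem: the greedy solution fills the items in order
  of increasing cost, and the reciprocal of the cost of the critical item is a multiplier
  with the same value.\<close>

lemma fractional_knapsack_duality:
  fixes d :: "'a::finite \<Rightarrow> real"
  assumes d: "\<And>i. 0 \<le> d i" and B: "0 \<le> B" "B < (\<Sum>i\<in>UNIV. d i)"
  obtains r l where "\<And>i. 0 \<le> r i" "\<And>i. r i \<le> 1" "(\<Sum>i\<in>UNIV. r i * d i) \<le> B" "0 \<le> l"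
    "l * B + (\<Sum>i\<in>UNIV. max 0 (1 - l * d i)) = (\<Sum>i\<in>UNIV. r i)"
proof -
  obtain t where t: "t \<in> range d" "(\<Sum>i | d i < t. d i) \<le> B" "B < (\<Sum>i | d i \<le> t. d i)"
    using exists_threshold[OF B] .
  define A where "A = (\<Sum>i | d i < t. d i)"
  define m where "m = real (card {i. d i = t})"
  have "{i. d i \<le> t} = {i. d i < t} \<union> {i. d i = t}" by auto
  then have "(\<Sum>i | d i \<le> t. d i) = A + (\<Sum>i | d i = t. d i)"
    by (simp only: A_def) (rule sum.union_disjoint; auto)
  then have Am: "(\<Sum>i | d i \<le> t. d i) = A + m * t" by (simp add: m_def)
  have "0 < m * t" using t(2,3) Am by (simp add: A_def)
  then have t0: "0 < t" and m0: "0 < m" by (auto simp: m_def zero_less_mult_iff)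
  \<comment> \<open>All items tied at cost \<open>t\<close> receive the same fraction, chosen so
    that the budget is used up exactly.\<close>
  define c where "c = (B - A) / (m * t)"
  have c: "0 \<le> c" "c \<le> 1" "A + c * m * t = B"
    using t Am t0 m0 by (auto simp: c_def A_def[symmetric] field_simps)
  define r where "r i = (if d i < t then 1 else if d i = t then c else 0)" for i
  have split: "(\<Sum>i\<in>UNIV. r i * g i) = (\<Sum>i | d i < t. g i) + c * (\<Sum>i | d i = t. g i)" for g
  proof -
    have "(\<Sum>i\<in>UNIV. r i * g i)
        = (\<Sum>i\<in>UNIV. (if d i < t then g i else 0) + (if d i = t then c * g i else 0))"
      by (rule sum.cong) (auto simp: r_def)
    then show ?thesis by (simp add: sum.distrib sum.If_cases sum_distrib_left)
  qed
  show thesis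
  proof (rule that[of r "1 / t"])
    show "(\<Sum>i\<in>UNIV. r i * d i) \<le> B"
      using split[of d] c(3) by (simp add: A_def m_def)
    \<comment> \<open>At \<open>l = 1 / t\<close> the items of cost at least \<open>t\<close>
      contribute nothing. Both values then equal the number of cheaper items plus
      \<open>c * m\<close>, since \<open>B - A = c * m * t\<close>.\<close>
    have "(\<Sum>i\<in>UNIV. max 0 (1 - 1 / t * d i)) = (\<Sum>i\<in>UNIV. if d i < t then 1 - d i / t else 0)"
      using t0 by (intro sum.cong) (auto simp: field_simps max_def)
    also have "\<dots> = (\<Sum>i | d i < t. 1 - d i / t)" by (simp add: sum.If_cases)
    also have "\<dots> = real (card {i. d i < t}) - A / t"
      by (simp add: A_def sum_subtractf sum_divide_distrib)
    moreover have "(\<Sum>i\<in>UNIV. r i) = real (card {i. d i < t}) + c * m"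
      using split[of "\<lambda>_. 1"] by (simp add: m_def)
    ultimately show "1 / t * B + (\<Sum>i\<in>UNIV. max 0 (1 - 1 / t * d i)) = (\<Sum>i\<in>UNIV. r i)"
      using t0 c(3) by (simp add: field_simps)
  qed (use t0 c in \<open>auto simp: r_def\<close>)
qed

section \<open>Multipliers from the chance constraint, for positive and zero radius\<close>

lemma reformulation_feasibleI:
  fixes x :: "real ^ 'N"
  assumes feas: "(yl, yu) \<in> chance_feasible x \<theta> \<beta>" and \<beta>: "0 \<le> \<beta>" "\<beta> < 1" and \<theta>: "0 < \<theta>"
    and x: "\<And>i. 0 \<le> x $ i"
  shows "\<exists>v. ((yl, yu), v) \<in> reformulation_feasible x \<theta> \<beta>"
proof -
  let ?d = "\<lambda>i. exit_dist yl yu (x $ i)"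
  note fractional = chance_feasible_fractional[OF feas \<beta>(1) \<theta> x]
  \<comment> \<open>Otherwise the budget would pay for moving all mass outside, forcing 1 \<le>
    \<beta>.\<close>
  have "\<theta> * real CARD('N) < (\<Sum>i\<in>UNIV. ?d i)"
  proof (rule ccontr)
    assume "\<not> ?thesis"
    then have "(\<Sum>i\<in>(UNIV::'N set). 1) \<le> \<beta> * real CARD('N)"
      by (intro fractional) auto
    then show False using \<beta> by simp
  qed
  then obtain r l where r: "\<And>i. 0 \<le> r i" "\<And>i. r i \<le> 1"
    "(\<Sum>i\<in>UNIV. r i * ?d i) \<le> \<theta> * real CARD('N)" and l: "0 \<le> l"
    "l * (\<theta> * real CARD('N)) + (\<Sum>i\<in>UNIV. max 0 (1 - l * ?d i)) = (\<Sum>i\<in>UNIV. r i)"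
    by (rule fractional_knapsack_duality[OF exit_dist_nonneg, rotated]) (use \<theta> in auto)
  have "l * (\<theta> * real CARD('N)) + (\<Sum>i\<in>UNIV. max 0 (1 - l * ?d i)) \<le> \<beta> * real CARD('N)"
    unfolding l(2) by (rule fractional[OF r])
  then have "l * \<theta> + (\<Sum>i\<in>UNIV. max 0 (1 - l * ?d i)) / real CARD('N) \<le> \<beta>"
    by (simp add: field_simps)
  then show ?thesis
    using feas l(1) unfolding reformulation_feasible_iff by (auto simp: chance_feasible_def)
qed

text \<open>The competitor is the empirical distribution itself: nothing moves, and \<open>r\<close>
  marks the samples already outside. At radius 0 a large multiplier is free, so it can push the
  price of every sample strictly inside down to 0.\<close>

lemma reformulation_feasibleI_radius_zero:
  fixes x :: "real ^ 'N"
  assumes feas: "(yl, yu) \<in> chance_feasible x 0 \<beta>" and \<beta>: "0 \<le> \<beta>"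
    and x: "\<And>i. 0 \<le> x $ i" and off: "\<And>i. x $ i \<noteq> yu" "\<And>i. 0 < yl \<Longrightarrow> x $ i \<noteq> yl"
  shows "\<exists>v. ((yl, yu), v) \<in> reformulation_feasible x 0 \<beta>"
proof -
  define r :: "'N \<Rightarrow> real" where "r i = of_bool (x $ i \<notin> {yl..yu})" for i
  \<comment> \<open>The sum dominates each single reciprocal, so \<open>l\<close> times any positive
    distance is at least 1. Samples at distance 0 add nothing, as division by 0 gives 0.\<close>
  define l where "l = (\<Sum>i\<in>UNIV. 1 / exit_dist yl yu (x $ i))"
  have l: "0 \<le> l" unfolding l_def by (intro sum_nonneg) (simp add: exit_dist_nonneg)
  have "max 0 (1 - l * exit_dist yl yu (x $ i)) \<le> r i" for i
  proof (cases "x $ i \<in> {yl..yu}")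
    case True
    then have pos: "0 < exit_dist yl yu (x $ i)"
      using off[of i] by (auto simp: exit_dist_def less_max_iff_disj)
    have "1 / exit_dist yl yu (x $ i) \<le> l"
      unfolding l_def by (rule member_le_sum) (auto simp: exit_dist_nonneg)
    then show ?thesis using pos by (simp add: field_simps r_def)
  next
    case False
    then show ?thesis using l exit_dist_nonneg[of yl yu "x $ i"] by (simp add: r_def)
  qed
  then have "(\<Sum>i\<in>UNIV. max 0 (1 - l * exit_dist yl yu (x $ i))) \<le> (\<Sum>i\<in>UNIV. r i)"
    by (intro sum_mono)
  also have "\<dots> \<le> \<beta> * real CARD('N)"
    by (rule chance_feasible_transport[OF feas \<beta> x, where z = "($) x"]) (auto simp: r_def x)
  finally have "l * 0 + (\<Sum>i\<in>UNIV. max 0 (1 - l * exit_dist yl yu (x $ i))) / real CARD('N) \<le> \<beta>"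
    by (simp add: field_simps)
  then show ?thesis
    using feas l unfolding reformulation_feasible_iff by (auto simp: chance_feasible_def)
qed

theorem mainTheorem2:
  fixes \<omega>_hat :: "real ^ 'n ^ 'N" and j :: 'n and \<alpha> \<theta> :: real
  assumes "0 < \<alpha>" and "\<alpha> < 1" and "0 \<le> \<theta>"
    and "\<And>i k. 0 \<le> \<omega>_hat $ i $ k"
  shows "(\<theta> > 0 \<longrightarrow>
            equivalent_programs
              (\<lambda>(yl, yu). yu - yl)
              (chance_feasible (column j \<omega>_hat) \<theta> (\<alpha> / real CARD('n)))
              (\<lambda>((yl, yu), (l, s)). yu - yl)
              (reformulation_feasible (column j \<omega>_hat) \<theta> (\<alpha> / real CARD('n))))
       \<and> (\<theta> = 0 \<longrightarrow>
            fst ` reformulation_feasible (column j \<omega>_hat) \<theta> (\<alpha> / real CARD('n))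
              \<subseteq> chance_feasible (column j \<omega>_hat) \<theta> (\<alpha> / real CARD('n)) \<and>
            {(yl, yu) \<in> chance_feasible (column j \<omega>_hat) \<theta> (\<alpha> / real CARD('n)).
               \<forall>i. \<omega>_hat $ i $ j \<noteq> yu \<and> (yl > 0 \<longrightarrow> \<omega>_hat $ i $ j \<noteq> yl)}
              \<subseteq> fst ` reformulation_feasible (column j \<omega>_hat) \<theta> (\<alpha> / real CARD('n)))"
proof -
  let ?x = "column j \<omega>_hat" and ?\<beta> = "\<alpha> / real CARD('n)"
  have x: "0 \<le> ?x $ i" for i using assms(4) by (simp add: column_def)
  have \<beta>: "0 \<le> ?\<beta>" using assms(1) by simp
  \<comment> \<open>The dimension is at least 1, so \<alpha> < 1 carries over to the bound on the
    exit probability.\<close>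
  have "\<alpha> < real CARD('n)"
    using assms(2) by (rule less_le_trans) (simp add: Suc_leI)
  then have \<beta>1: "?\<beta> < 1" by simp
  note to_chance = chance_feasibleI[OF assms(3), of _ _ ?x ?\<beta>]
  show ?thesis
  proof (intro conjI impI)
    assume "0 < \<theta>"
    then show "equivalent_programs (\<lambda>(yl, yu). yu - yl) (chance_feasible ?x \<theta> ?\<beta>)
        (\<lambda>((yl, yu), (l, s)). yu - yl) (reformulation_feasible ?x \<theta> ?\<beta>)"
      unfolding equivalent_programs_def
      using to_chance reformulation_feasibleI[OF _ \<beta> \<beta>1 _ x] by (auto simp: split_paired_all)
  next
    show "fst ` reformulation_feasible ?x \<theta> ?\<beta> \<subseteq> chance_feasible ?x \<theta> ?\<beta>"
      using to_chance by force
  next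
    assume "\<theta> = 0"
    show "{(yl, yu) \<in> chance_feasible ?x \<theta> ?\<beta>.
        \<forall>i. \<omega>_hat $ i $ j \<noteq> yu \<and> (yl > 0 \<longrightarrow> \<omega>_hat $ i $ j \<noteq> yl)}
        \<subseteq> fst ` reformulation_feasible ?x \<theta> ?\<beta>"
    proof clarify
      fix yl yu
      assume "(yl, yu) \<in> chance_feasible ?x \<theta> ?\<beta>"
        and "\<forall>i. \<omega>_hat $ i $ j \<noteq> yu \<and> (yl > 0 \<longrightarrow> \<omega>_hat $ i $ j \<noteq> yl)"
      then have "\<exists>v. ((yl, yu), v) \<in> reformulation_feasible ?x 0 ?\<beta>"
        unfolding \<open>\<theta> = 0\<close>
        by (intro reformulation_feasibleI_radius_zero[OF _ \<beta> x]) (auto simp: column_def)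
      then show "(yl, yu) \<in> fst ` reformulation_feasible ?x \<theta> ?\<beta>"
        unfolding \<open>\<theta> = 0\<close> by force
    qed
  qed
qed

end
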